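(* For every integer $n>0$, $s_{c'}(n)-s_e(n)$ equals twice the number of partitions of $n$ into even parts in which exactly one part size occurs more than once, plus the number of partitions of $n$ into distinct even parts with even $M_2$-rank.
   Context: For a partition $\lambda$ with conjugate $\lambda'$ (cells $(i,j)$ = row $i$, column $j$ of the Young diagram; $\lambda_i=0$ beyond the length), the symplectic content of a cell is $c^\lambda_{sp}(i,j)=\lambda_i+\lambda_j-i-j+2$ if $i>j$ and $c^\lambda_{sp}(i,j)=i+j-\lambda'_i-\lambda'_j$ if $i\le j$. $s_{c'}(n)$ is the total number of parts of all partitions $\lambda$ of $n$ with $c^\lambda_{sp}(u)\ne0$ for all cells $u\in\lambda$; $s_e(n)$ is the total number of parts of all partitions of $n$ into distinct even parts. The $M_2$-rank of a partition $\lambda$ with largest part $\lambda_1$ and $\ell(\lambda)$ parts is $\lceil \lambda_1/2\rceil-\ell(\lambda)$. *)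

theory Defs
  imports Complex_Main
begin

text \<open>A partition is the weakly decreasing list of its (positive) parts.\<close>

definition partitions :: "nat \<Rightarrow> nat list set" where
  "partitions n = {ps. sorted_wrt (\<ge>) ps \<and> (\<forall>p\<in>set ps. p > 0) \<and> sum_list ps = n}"

text \<open>Sums and cardinalities over subsets of \<open>partitions n\<close> are honest, since this set is finite.\<close>

lemma finite_partitions: "finite (partitions n)"
proof (rule finite_subset)
  have len: "length xs \<le> sum_list xs" if "\<forall>p\<in>set xs. p > 0" for xs :: "nat list"
    using that by (induction xs) auto
  show "partitions n \<subseteq> {xs. set xs \<subseteq> {..n} \<and> length xs \<le> n}"
    using len by (auto simp: partitions_def intro: member_le_sum_list)
  show "finite {xs. set xs \<subseteq> {..n} \<and> length xs \<le> n}"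
    by (rule finite_lists_length_le) simp
qed

text \<open>\<open>part ps i\<close> is the \<open>i\<close>-th part, with rows and columns numbered from 1; it is 0 beyond the length.
  The value at \<open>i = 0\<close> is a dummy.\<close>

definition part :: "nat list \<Rightarrow> nat \<Rightarrow> nat" where
  "part ps i = (if 1 \<le> i \<and> i \<le> length ps then ps ! (i - 1) else 0)"

definition cells :: "nat list \<Rightarrow> (nat \<times> nat) set" where
  "cells ps = {(i, j). 1 \<le> i \<and> i \<le> length ps \<and> 1 \<le> j \<and> j \<le> part ps i}"

text \<open>The \<open>j\<close>-th part of the conjugate partition, i.e. the length of column \<open>j\<close>;
  0 beyond the last column.\<close>

definition conj_part :: "nat list \<Rightarrow> nat \<Rightarrow> nat" where
  "conj_part ps j = card {i. (i, j) \<in> cells ps}"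

fun sp_content :: "nat list \<Rightarrow> nat \<times> nat \<Rightarrow> int" where
  "sp_content ps (i, j) =
     (if i > j then int (part ps i) + int (part ps j) - int i - int j + 2
      else int i + int j - int (conj_part ps i) - int (conj_part ps j))"

definition s_c' :: "nat \<Rightarrow> nat" where
  "s_c' n = (\<Sum>ps\<in>{ps \<in> partitions n. \<forall>u\<in>cells ps. sp_content ps u \<noteq> 0}. length ps)"

definition even_partitions :: "nat \<Rightarrow> nat list set" where
  "even_partitions n = {ps \<in> partitions n. \<forall>p\<in>set ps. even p}"

definition distinct_even_partitions :: "nat \<Rightarrow> nat list set" where
  "distinct_even_partitions n = {ps \<in> even_partitions n. distinct ps}"

definition s_e :: "nat \<Rightarrow> nat" where
  "s_e n = (\<Sum>ps\<in>distinct_even_partitions n. length ps)"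

definition M2_rank :: "nat list \<Rightarrow> int" where
  "M2_rank ps = \<lceil>real (part ps 1) / 2\<rceil> - int (length ps)"

end

theory Submission
  imports "HOL-Library.Multiset" Defs
begin

text \<open>
  Peeling off first hooks shows that the partitions of \<open>n\<close> without vanishing symplectic contents are
  the ones of Frobenius form \<open>(a\<^sub>1, \<dots>, a\<^sub>d | a\<^sub>1 + 1, \<dots>, a\<^sub>d + 1)\<close>. They correspond to the partitions
  \<open>\<mu>\<close> of \<open>m = n / 2\<close> into distinct parts \<open>\<mu>\<^sub>i = a\<^sub>i + 1\<close>, and have \<open>\<mu>\<^sub>1 + 1\<close> parts. With the rank
  \<open>r = \<mu>\<^sub>1 - \<ell>(\<mu>)\<close> the theorem becomes: \<open>\<Sum>\<lceil>r / 2\<rceil>\<close> over all such \<open>\<mu>\<close> is the number of partitions of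
  \<open>m\<close> in which exactly one part size is repeated. Splitting off the maximal even number of copies of
  the repeated part, the latter is the number of triples \<open>(\<mu>, k, e)\<close> with \<open>\<mu>\<close> strict, \<open>k, e > 0\<close> and
  \<open>|\<mu>| + 2ke = m\<close>.

  Dyson's map (remove the first column, insert a new first row) gives for the generating function
  \<open>C\<^sub>j\<close> of strict partitions with \<open>r \<le> 2j\<close> the recurrence \<open>C\<^sub>j = C\<^bsub>j-1\<^esub> + q\<^bsup>2j\<^esup> C\<^sub>j\<close>. Writing \<open>C\<close> for
  their limit, \<open>W\<^sub>k = \<Sum>\<^sub>j q\<^bsup>2jk\<^esup> C\<^sub>j\<close> and \<open>T\<^sub>k = \<Sum>\<^sub>j j q\<^bsup>2jk\<^esup> C\<^sub>j\<close>, it follows that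
  \<open>W\<^bsub>k+1\<^esub> = (1 - q\<^bsup>2k\<^esup>) W\<^sub>k\<close>, \<open>T\<^bsub>k+1\<^esub> = (1 - q\<^bsup>2k\<^esup>) T\<^sub>k - q\<^bsup>2k\<^esup> W\<^sub>k\<close> and \<open>W\<^sub>1 = C\<close>, hence
  \<open>\<Sum> \<lceil>r / 2\<rceil> q\<^bsup>|\<mu>|\<^esup> = T\<^sub>1 = C \<cdot> \<Sum>\<^sub>k q\<^bsup>2k\<^esup> / (1 - q\<^bsup>2k\<^esup>)\<close>.
\<close>

section \<open>Partitions without vanishing symplectic contents\<close>

definition strict_partition :: "nat list \<Rightarrow> bool" where
  "strict_partition xs \<longleftrightarrow> sorted_wrt (>) xs \<and> (\<forall>x\<in>set xs. x > 0)"

definition distinct_partitions :: "nat \<Rightarrow> nat list set" where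
  "distinct_partitions m = {xs. strict_partition xs \<and> sum_list xs = m}"

definition sp_nonzero :: "nat list \<Rightarrow> bool" where
  "sp_nonzero ps \<longleftrightarrow> (\<forall>u\<in>cells ps. sp_content ps u \<noteq> 0)"

text \<open>The diagram of \<open>qs\<close> moved one step down the diagonal, inside a new first
  hook with row length \<open>p\<close> and column length \<open>length qs + k + 1\<close>.\<close>

definition wrap_hook :: "nat \<Rightarrow> nat list \<Rightarrow> nat \<Rightarrow> nat list" where
  "wrap_hook p qs k = p # map Suc qs @ replicate k 1"

text \<open>Each part \<open>p\<close> becomes a hook with arm \<open>p - 1\<close> and leg
  \<open>p\<close>. The subtraction is exact on strict partitions, where the inner diagram has at
  most \<open>p\<close> rows.\<close>

fun doubled :: "nat list \<Rightarrow> nat list" where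
  "doubled [] = []"
| "doubled (p # ps) = wrap_hook p (doubled ps) (p - length (doubled ps))"

section \<open>Row lengths, column lengths and contents after adding a first hook\<close>

lemma conj_part_eq_length_filter:
  assumes "j > 0"
  shows "conj_part ps j = length (filter (\<lambda>x. j \<le> x) ps)"
proof -
  have "{i. (i, j) \<in> cells ps} = Suc ` {i. i < length ps \<and> j \<le> ps ! i}"
  proof (intro set_eqI iffI)
    fix i assume "i \<in> {i. (i, j) \<in> cells ps}"
    then show "i \<in> Suc ` {i. i < length ps \<and> j \<le> ps ! i}"
      by (intro image_eqI[of _ _ "i - 1"]) (auto simp: cells_def part_def)
  qed (use assms in \<open>auto simp: cells_def part_def\<close>)
  then show ?thesis
    by (simp add: conj_part_def length_filter_conv_card card_image)
qed

lemma cells_iff: "(i, j) \<in> cells ps \<longleftrightarrow> 0 < i \<and> i \<le> length ps \<and> 0 < j \<and> j \<le> part ps i"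
  by (auto simp: cells_def)

lemma length_wrap_hook [simp]: "length (wrap_hook p qs k) = Suc (length qs + k)"
  by (simp add: wrap_hook_def)

lemma part_wrap_hook_1 [simp]: "part (wrap_hook p qs k) (Suc 0) = p"
  by (simp add: wrap_hook_def part_def)

lemma part_wrap_hook_Suc:
  assumes "0 < i"
  shows "part (wrap_hook p qs k) (Suc i) =
    (if i \<le> length qs then Suc (part qs i) else if i \<le> length qs + k then 1 else 0)"
  using assms by (auto simp: wrap_hook_def part_def nth_append)

lemma conj_part_wrap_hook_1:
  assumes "0 < p"
  shows "conj_part (wrap_hook p qs k) (Suc 0) = Suc (length qs + k)"
proof -
  have "filter (\<lambda>x. Suc 0 \<le> x) (wrap_hook p qs k) = wrap_hook p qs k"
    using assms by (intro filter_True) (auto simp: wrap_hook_def)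
  then show ?thesis
    by (simp add: conj_part_eq_length_filter)
qed

lemma conj_part_wrap_hook_Suc:
  assumes "0 < j"
  shows "conj_part (wrap_hook p qs k) (Suc j) = (if j < p then 1 else 0) + conj_part qs j"
  using assms
  by (simp add: conj_part_eq_length_filter wrap_hook_def filter_map o_def Suc_le_eq less_Suc_eq_le)

lemma conj_part_pos:
  assumes "(i, j) \<in> cells ps"
  shows "0 < conj_part ps j"
proof -
  have "finite {i. (i, j) \<in> cells ps}"
    by (rule finite_subset[of _ "{..length ps}"]) (auto simp: cells_def)
  then show ?thesis
    using assms unfolding conj_part_def by (subst card_gt_0_iff) auto
qed

text \<open>The diagonal shift raises \<open>i + j\<close> by 2 and both row lengths, or both column
  lengths, by 1; these changes cancel in either case of the content.\<close>

lemma sp_content_wrap_hook_Suc: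
  assumes "\<forall>x\<in>set qs. x < p" "(i, j) \<in> cells qs"
  shows "sp_content (wrap_hook p qs k) (Suc i, Suc j) = sp_content qs (i, j)"
proof (cases "i > j")
  case True
  then show ?thesis using assms by (simp add: cells_iff part_wrap_hook_Suc)
next
  case False
  have ij: "0 < i" "0 < j" "i \<le> length qs" "j \<le> part qs i"
    using assms by (auto simp: cells_iff)
  moreover from this have "part qs i < p"
    using assms(1) by (auto simp: part_def)
  ultimately have "j < p" "i < p" using False by auto
  then show ?thesis using ij False by (simp add: conj_part_wrap_hook_Suc)
qed

lemma Suc_in_cells_wrap_hook:
  assumes "0 < i" "0 < j"
  shows "(Suc i, Suc j) \<in> cells (wrap_hook p qs k) \<longleftrightarrow> (i, j) \<in> cells qs"
  using assms by (auto simp: cells_iff part_wrap_hook_Suc)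

lemma sp_nonzero_wrap_hookD:
  assumes bound: "\<forall>x\<in>set qs. x < p" and nz: "sp_nonzero (wrap_hook p qs k)"
  shows "sp_nonzero qs"
  unfolding sp_nonzero_def
proof
  fix u assume u: "u \<in> cells qs"
  obtain i j where [simp]: "u = (i, j)" by fastforce
  have "(Suc i, Suc j) \<in> cells (wrap_hook p qs k)"
    using u by (subst Suc_in_cells_wrap_hook) (auto simp: cells_iff)
  then show "sp_content qs u \<noteq> 0"
    using nz sp_content_wrap_hook_Suc[OF bound, of i j k] u
    unfolding sp_nonzero_def by fastforce
qed

text \<open>A deviation from \<open>length qs + k = p\<close> is witnessed by a zero of the content in the first column
  (at row \<open>p + 2\<close>) or in the first row (at column \<open>length qs + k + 1\<close>).\<close>

lemma sp_nonzero_wrap_hook: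
  assumes bound: "\<forall>x\<in>set qs. x < p" and "0 < p"
    and small: "\<forall>x\<in>set qs. x < length qs" and short: "length qs \<le> p"
  shows "sp_nonzero (wrap_hook p qs k) \<longleftrightarrow> sp_nonzero qs \<and> length qs + k = p"
proof (intro iffI conjI)
  let ?ps = "wrap_hook p qs k"
  assume nz: "sp_nonzero ?ps"
  show "sp_nonzero qs" using sp_nonzero_wrap_hookD[OF bound nz] .
  show "length qs + k = p"
  proof (rule ccontr)
    assume "length qs + k \<noteq> p"
    then consider "p < length qs + k" | "length qs + k < p" by linarith
    then show False
    proof cases
      case 1
      \<comment> \<open>By \<open>short\<close>, row \<open>p + 2\<close> is one of the trailing
        ones; its content in column 1 is \<open>1 + p - (p + 2) - 1 + 2 = 0\<close>.\<close>
      have "part ?ps (Suc (Suc p)) = 1"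
        using 1 short by (simp add: part_wrap_hook_Suc)
      then have "(Suc (Suc p), Suc 0) \<in> cells ?ps" "sp_content ?ps (Suc (Suc p), Suc 0) = 0"
        using 1 \<open>0 < p\<close> by (auto simp: cells_iff)
      then show False using nz unfolding sp_nonzero_def by blast
    next
      case 2
      let ?l = "Suc (length qs + k)"
      \<comment> \<open>Only the first row reaches column \<open>?l\<close>, by
        \<open>small\<close>; the content there is \<open>1 + ?l - ?l - 1 = 0\<close>.\<close>
      have "conj_part ?ps ?l = 1"
      proof (cases "length qs + k = 0")
        case False
        have "filter (\<lambda>x. length qs + k \<le> x) qs = []"
          using small by (auto simp: filter_empty_conv)
        then have "conj_part qs (length qs + k) = 0"
          using False by (subst conj_part_eq_length_filter) auto
        then show ?thesis
          using 2 False by (subst conj_part_wrap_hook_Suc) auto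
      qed (use \<open>0 < p\<close> in \<open>simp add: conj_part_wrap_hook_1\<close>)
      then have "(Suc 0, ?l) \<in> cells ?ps" "sp_content ?ps (Suc 0, ?l) = 0"
        using 2 \<open>0 < p\<close> by (auto simp: cells_iff conj_part_wrap_hook_1)
      then show False using nz unfolding sp_nonzero_def by blast
    qed
  qed
next
  let ?ps = "wrap_hook p qs k"
  assume hyp: "sp_nonzero qs \<and> length qs + k = p"
  show "sp_nonzero ?ps"
    unfolding sp_nonzero_def
  proof
    fix u assume u: "u \<in> cells ?ps"
    obtain i j where ij: "u = (i, j)" by fastforce
    \<comment> \<open>Contents are negative in the first row, since \<open>j \<le> p\<close> and
      columns are nonempty, and positive below it in the first column, since
      \<open>i \<le> p + 1\<close>. All other cells come from \<open>qs\<close>.\<close>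
    consider "i = 1" | "i > 1" "j = 1" | i' j' where "i = Suc i'" "j = Suc j'" "0 < i'" "0 < j'"
      using u ij by (cases i; cases j) (auto simp: cells_iff)
    then show "sp_content ?ps u \<noteq> 0"
    proof cases
      case 1
      then show ?thesis
        using conj_part_pos[of i j ?ps] u ij hyp \<open>0 < p\<close>
        by (auto simp: cells_iff conj_part_wrap_hook_1)
    next
      case 2
      then show ?thesis using u ij hyp by (auto simp: cells_iff)
    next
      case 3
      then show ?thesis
        using u ij hyp Suc_in_cells_wrap_hook[of i' j' p qs k]
          sp_content_wrap_hook_Suc[OF bound, of i' j' k]
        by (auto simp: sp_nonzero_def simp del: sp_content.simps)
    qed
  qed
qed

section \<open>Strict partitions and the doubling map\<close>

lemma strict_partition_Nil [simp]: "strict_partition []"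
  by (simp add: strict_partition_def)

lemma strict_partition_Cons:
  "strict_partition (x # xs) \<longleftrightarrow> 0 < x \<and> (\<forall>y\<in>set xs. y < x) \<and> strict_partition xs"
  by (auto simp: strict_partition_def)

lemma part_1_eq: "part xs (Suc 0) = (case xs of [] \<Rightarrow> 0 | x # _ \<Rightarrow> x)"
  by (auto simp: part_def split: list.split)

lemma length_le_part_1:
  assumes "strict_partition xs"
  shows "length xs \<le> part xs 1"
  using assms
proof (induction xs)
  case (Cons x xs)
  then show ?case by (cases xs) (auto simp: part_1_eq strict_partition_Cons)
qed simp

text \<open>One induction carries everything, because the bounds on the inner diagram are the
  hypotheses of \<open>sp_nonzero_wrap_hook\<close> for the next hook. That hook has
  \<open>x\<close> cells in its row and \<open>x\<close> below it, so the size doubles.\<close>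

lemma doubled_properties:
  assumes "strict_partition xs"
  shows "sorted_wrt (\<ge>) (doubled xs) \<and> (\<forall>p\<in>set (doubled xs). 0 < p \<and> p \<le> part xs 1)
    \<and> length (doubled xs) = (if xs = [] then 0 else Suc (part xs 1))
    \<and> sum_list (doubled xs) = 2 * sum_list xs \<and> sp_nonzero (doubled xs)"
  using assms
proof (induction xs)
  case Nil
  show ?case by (simp add: sp_nonzero_def cells_def)
next
  case (Cons x xs)
  let ?qs = "doubled xs"
  from Cons have IH: "sorted_wrt (\<ge>) ?qs" "\<forall>p\<in>set ?qs. 0 < p \<and> p \<le> part xs 1"
    "length ?qs = (if xs = [] then 0 else Suc (part xs 1))"
    "sum_list ?qs = 2 * sum_list xs" "sp_nonzero ?qs"
    by (auto simp: strict_partition_Cons)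
  have x: "0 < x" "part xs 1 < x"
    using Cons.prems by (auto simp: strict_partition_Cons part_1_eq split: list.split)
  have len: "length ?qs \<le> x" using IH(3) x by auto
  have bound: "\<forall>p\<in>set ?qs. p < x" using IH(2) x by fastforce
  have "\<forall>p\<in>set ?qs. p < length ?qs" using IH(2,3) by fastforce
  then have "sp_nonzero (wrap_hook x ?qs (x - length ?qs))"
    using sp_nonzero_wrap_hook[OF bound x(1) _ len] IH(5) len by simp
  moreover have "sum_list (map Suc ?qs) = sum_list ?qs + length ?qs"
    by (induction ?qs) (simp_all add: sum_list_Suc)
  moreover have "sorted_wrt (\<ge>) (map Suc ?qs @ replicate k 1)" for k
  proof -
    have "sorted_wrt (\<ge>) (replicate k (1::nat))" by (induction k) auto
    then show ?thesis using IH(1) by (simp add: sorted_wrt_append sorted_wrt_map)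
  qed
  ultimately show ?case
    using IH len bound x
    by (auto simp: wrap_hook_def part_1_eq sum_list_replicate Suc_le_eq)
qed

text \<open>Dropping the first row, keeping the parts above 1 and subtracting 1 recovers
  \<open>qs\<close>; positivity of \<open>qs\<close> separates \<open>map Suc qs\<close> from the
  ones.\<close>

lemma wrap_hook_inject:
  assumes "\<forall>x\<in>set qs. 0 < x" "\<forall>x\<in>set qs'. 0 < x" "wrap_hook p qs k = wrap_hook p' qs' k'"
  shows "p = p' \<and> qs = qs'"
proof -
  have "map (\<lambda>x. x - 1) (filter (\<lambda>x. 1 < x) (tl (wrap_hook p qs k))) = qs"
    if "\<forall>x\<in>set qs. 0 < x" for p qs k
  proof -
    have "filter (\<lambda>x. 1 < x) (map Suc qs) = map Suc qs"
      using that by (intro filter_True) auto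
    then show ?thesis by (simp add: wrap_hook_def o_def filter_empty_conv)
  qed
  from this[OF assms(1), of p k] this[OF assms(2), of p' k'] assms(3)
  have "qs = qs'" by metis
  with assms(3) show ?thesis by (simp add: wrap_hook_def)
qed

lemma inj_on_doubled: "inj_on doubled (Collect strict_partition)"
proof -
  have "doubled xs = doubled ys \<Longrightarrow> xs = ys" if "strict_partition xs" "strict_partition ys" for xs ys
    using that
  proof (induction xs arbitrary: ys)
    case Nil
    then show ?case by (cases ys) (auto simp: wrap_hook_def)
  next
    case (Cons x xs)
    from Cons.prems obtain y ys' where ys: "ys = y # ys'"
      by (cases ys) (auto simp: wrap_hook_def)
    from Cons.prems have st: "strict_partition xs" "strict_partition ys'"
      by (auto simp: ys strict_partition_Cons)
    from wrap_hook_inject[OF _ _ Cons.prems(1)[unfolded ys doubled.simps]]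
    have "x = y \<and> doubled xs = doubled ys'"
      using doubled_properties[OF st(1)] doubled_properties[OF st(2)] by blast
    then show ?case using Cons.IH st by (simp add: ys)
  qed
  then show ?thesis by (auto simp: inj_on_def)
qed

text \<open>Removal of the first column: \<open>qs\<close> remains, and \<open>k\<close> rows of a
  single cell disappear.\<close>

lemma ex_map_Suc_append_ones:
  assumes "sorted_wrt (\<ge>) xs" "\<forall>x\<in>set xs. 0 < x"
  shows "\<exists>qs k. xs = map Suc qs @ replicate k 1 \<and> sorted_wrt (\<ge>) qs \<and> (\<forall>x\<in>set qs. 0 < x)"
  using assms
proof (induction xs)
  case (Cons x xs)
  from Cons.prems have "sorted_wrt (\<ge>) xs" "\<forall>x\<in>set xs. 0 < x" by auto
  from Cons.IH[OF this] obtain qs k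
    where IH: "xs = map Suc qs @ replicate k 1" "sorted_wrt (\<ge>) qs" "\<forall>x\<in>set qs. 0 < x"
    by blast
  have le: "\<forall>y\<in>set qs. Suc y \<le> x" using Cons.prems(1) unfolding IH(1) by simp
  show ?case
  proof (cases "x = 1")
    case True
    have "qs = []"
    proof (rule ccontr)
      assume "qs \<noteq> []"
      then have "hd qs \<in> set qs" by simp
      then show False using le IH(3) True by fastforce
    qed
    then have "x # xs = map Suc [] @ replicate (Suc k) 1" using True IH(1) by simp
    then show ?thesis by (metis list.set(1) ball_empty sorted_wrt.simps(1))
  next
    case False
    then have "1 < x" using Cons.prems(2) by simp
    then have "x # xs = map Suc ((x - 1) # qs) @ replicate k 1" using IH(1) by simp
    moreover have "sorted_wrt (\<ge>) ((x - 1) # qs) \<and> (\<forall>y\<in>set ((x - 1) # qs). 0 < y)"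
      using IH(2,3) le \<open>1 < x\<close> by fastforce
    ultimately show ?thesis by blast
  qed
qed simp

text \<open>Peel off the first hook. By induction the inner diagram is doubled, which supplies the
  bounds under which \<open>sp_nonzero_wrap_hook\<close> forces the leg to be
  \<open>p\<close>.\<close>

lemma sp_nonzero_imp_doubled:
  assumes "sorted_wrt (\<ge>) ps" "\<forall>x\<in>set ps. 0 < x" "sp_nonzero ps"
  shows "\<exists>xs. strict_partition xs \<and> ps = doubled xs"
  using assms
proof (induction "length ps" arbitrary: ps rule: less_induct)
  case less
  show ?case
  proof (cases ps)
    case Nil
    then show ?thesis by (intro exI[of _ "[]"]) simp
  next
    case (Cons p ps')
    with less.prems have "sorted_wrt (\<ge>) ps'" "\<forall>x\<in>set ps'. 0 < x" by auto
    from ex_map_Suc_append_ones[OF this] obtain qs k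
      where qs: "ps' = map Suc qs @ replicate k 1" "sorted_wrt (\<ge>) qs" "\<forall>x\<in>set qs. 0 < x"
      by blast
    have ps: "ps = wrap_hook p qs k" by (simp add: Cons qs(1) wrap_hook_def)
    have "0 < p" using less.prems(2) Cons by simp
    have "\<forall>x\<in>set ps'. x \<le> p" using less.prems(1) Cons by simp
    then have "\<forall>x\<in>set qs. Suc x \<le> p" unfolding qs(1) by simp
    then have "\<forall>x\<in>set qs. x < p" by (simp add: Suc_le_eq)
    note p = \<open>0 < p\<close> this
    have "sp_nonzero qs"
      by (rule sp_nonzero_wrap_hookD[OF p(2), of k]) (use less.prems(3) in \<open>simp only: ps\<close>)
    moreover have "length qs < length ps" by (simp add: ps)
    ultimately obtain xs where xs: "strict_partition xs" "qs = doubled xs"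
      using less.hyps[OF _ qs(2,3)] by blast
    note dp = doubled_properties[OF xs(1), folded xs(2)]
    have hd: "xs = [] \<or> part xs 1 \<in> set qs"
      using xs(2) by (cases xs) (auto simp: part_1_eq wrap_hook_def)
    have less: "part xs 1 < p"
      using hd
    proof
      assume "xs = []"
      then show ?thesis using p(1) by (simp add: part_1_eq)
    qed (use p(2) in blast)
    then have "length qs \<le> p" using dp by (simp split: if_splits)
    moreover have "\<forall>x\<in>set qs. x < length qs"
      using dp xs(2) by (cases "xs = []") (simp_all add: less_Suc_eq_le)
    ultimately have "length qs + k = p"
      using sp_nonzero_wrap_hook[OF p(2,1), of k] less.prems(3) ps by simp
    then have "ps = doubled (p # xs)" using xs(2) ps by auto
    moreover have "strict_partition (p # xs)"
      using xs(1) p(1) less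
      by (cases xs) (auto simp: strict_partition_Cons part_1_eq)
    ultimately show ?thesis by blast
  qed
qed

lemma sp_nonzero_partitions_eq:
  "{ps \<in> partitions n. sp_nonzero ps} =
    (if even n then doubled ` distinct_partitions (n div 2) else {})"
proof -
  have "ps \<in> partitions n \<and> sp_nonzero ps \<longleftrightarrow>
      (\<exists>xs. strict_partition xs \<and> 2 * sum_list xs = n \<and> ps = doubled xs)" for ps
  proof
    assume ps: "ps \<in> partitions n \<and> sp_nonzero ps"
    then obtain xs where "strict_partition xs" "ps = doubled xs"
      using sp_nonzero_imp_doubled[of ps] by (auto simp: partitions_def)
    with ps doubled_properties[of xs]
    show "\<exists>xs. strict_partition xs \<and> 2 * sum_list xs = n \<and> ps = doubled xs"
      by (auto simp: partitions_def intro!: exI[of _ xs])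
  next
    assume "\<exists>xs. strict_partition xs \<and> 2 * sum_list xs = n \<and> ps = doubled xs"
    then obtain xs where "strict_partition xs" "2 * sum_list xs = n" "ps = doubled xs" by blast
    with doubled_properties[of xs] show "ps \<in> partitions n \<and> sp_nonzero ps"
      by (auto simp: partitions_def)
  qed
  then show ?thesis by (auto simp: distinct_partitions_def)
qed

text \<open>For \<open>0 < m\<close> no \<open>xs\<close> is empty, so every doubled diagram has
  \<open>Suc (part xs 1)\<close> rows.\<close>

lemma s_c'_even:
  assumes "0 < m"
  shows "s_c' (2 * m) = (\<Sum>xs\<in>distinct_partitions m. Suc (part xs 1))"
proof -
  have "s_c' (2 * m) = sum length (doubled ` distinct_partitions m)"
    using sp_nonzero_partitions_eq[of "2 * m"] by (simp add: s_c'_def sp_nonzero_def)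
  also have "\<dots> = (\<Sum>xs\<in>distinct_partitions m. length (doubled xs))"
    using inj_on_doubled
    by (intro sum.reindex_cong[OF inj_on_subset]) (auto simp: distinct_partitions_def)
  also have "\<dots> = (\<Sum>xs\<in>distinct_partitions m. Suc (part xs 1))"
    using assms doubled_properties by (intro sum.cong) (auto simp: distinct_partitions_def)
  finally show ?thesis .
qed

lemma s_c'_odd: "odd n \<Longrightarrow> s_c' n = 0"
  using sp_nonzero_partitions_eq[of n] unfolding s_c'_def sp_nonzero_def
  by (simp only: if_False sum.empty)

section \<open>Summation of the rank recurrence\<close>

text \<open>Exponents are integers so that shifts never truncate; coefficients at negative exponents
  are 0.\<close>

locale dyson_recurrence =
  fixes c :: "nat \<Rightarrow> int \<Rightarrow> int"
  assumes neg: "m < 0 \<Longrightarrow> c j m = 0"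
    and rec: "c (Suc j) m = c j m + c (Suc j) (m - 2 * int (Suc j))"
begin

text \<open>With \<open>c j m\<close> the coefficient of \<open>q\<^sup>m\<close> in \<open>C\<^sub>j\<close>, this is the coefficient of \<open>q\<^sup>m\<close> in
  \<open>\<Sum>\<^sub>j w\<^sub>j q\<^bsup>2jk\<^esup> C\<^sub>j\<close>; the truncation at \<open>N\<close> is harmless for \<open>m \<le> N\<close>.\<close>

definition shifted_sum :: "(nat \<Rightarrow> int) \<Rightarrow> nat \<Rightarrow> nat \<Rightarrow> int \<Rightarrow> int" where
  "shifted_sum w N k m = (\<Sum>j\<le>N. w j * c j (m - 2 * int (j * k)))"

lemma shifted_sum_neg: "m < 0 \<Longrightarrow> shifted_sum w N k m = 0"
proof -
  assume "m < 0"
  moreover have "0 \<le> int (j * k)" for j by simp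
  ultimately have "m - 2 * int (j * k) < 0" for j
    by (smt (verit))
  then show ?thesis unfolding shifted_sum_def by (simp add: neg)
qed

text \<open>By \<open>rec\<close>, multiplying C_j by q^(2j) gives C_j - C_(j-1), with C_(-1) read
  as 0. Reindexing the subtracted sum shifts the weight and releases a factor q^(2k).\<close>

lemma shifted_sum_Suc:
  assumes "m \<le> int N" "0 < k"
  shows "shifted_sum w N (Suc k) m =
    shifted_sum w N k m - shifted_sum (\<lambda>j. w (Suc j)) N k (m - 2 * int k)"
proof -
  \<comment> \<open>The reindexed sum stops at \<open>N - 1\<close>; its term at \<open>N\<close>
    can be added because the exponent is negative.\<close>
  have "m - 2 * int k - 2 * int (N * k) < 0"
  proof -
    have "int N * 1 \<le> int N * int k" using assms by (intro mult_left_mono) auto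
    then show ?thesis using assms by simp
  qed
  then have last: "c N (m - 2 * int k - 2 * int (N * k)) = 0" by (rule neg)
  have "(\<Sum>j\<le>M. w j * c j (m - 2 * int (j * Suc k))) =
      (\<Sum>j\<le>M. w j * c j (m - 2 * int (j * k)))
      - (\<Sum>j<M. w (Suc j) * c j (m - 2 * int k - 2 * int (j * k)))" for M
  proof (induction M)
    case (Suc M)
    have "c (Suc M) (m - 2 * int (Suc M * Suc k)) =
        c (Suc M) (m - 2 * int (Suc M * k)) - c M (m - 2 * int k - 2 * int (M * k))"
      using rec[of M "m - 2 * int (Suc M * k)"] by (simp add: algebra_simps)
    then show ?case
      using Suc by (simp only: sum.atMost_Suc sum.lessThan_Suc right_diff_distrib)
  qed simp
  from this[of N] last show ?thesis
    by (simp add: shifted_sum_def lessThan_Suc_atMost[symmetric])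
qed

text \<open>The terms q^(2j) C_j telescope by \<open>rec\<close>: this is W_1 = C, truncated at
  \<open>N\<close>.\<close>

lemma shifted_sum_1: "shifted_sum (\<lambda>_. 1) N 1 m = c N m"
proof -
  have "(\<Sum>j\<le>N. c j (m - 2 * int j)) = c N m"
  proof (induction N)
    case (Suc N)
    then show ?case using rec[of N m] by simp
  qed simp
  then show ?thesis by (simp add: shifted_sum_def)
qed

text \<open>Coefficient form of T_k = W_k * (sum over l \<ge> k of q^(2l) / (1 - q^(2l))), with
  geometric series expanded over \<open>e\<close>. Descending induction on \<open>k\<close>, using
  the recurrences for T and W.\<close>

lemma shifted_sum_weighted:
  assumes "k \<le> Suc N" "0 < k" "m \<le> int N"
  shows "shifted_sum int N k m =
    (\<Sum>l=k..N. \<Sum>e=1..N. shifted_sum (\<lambda>_. 1) N k (m - 2 * int (l * e)))"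
  using assms
proof (induction k arbitrary: m rule: inc_induct)
  case base
  \<comment> \<open>At \<open>k = N + 1\<close> only \<open>j = 0\<close> survives the degree bound,
    and its weight is 0.\<close>
  have "c j (m - 2 * int (j * Suc N)) = 0" if "0 < j" for j
  proof (rule neg)
    have "N < j * Suc N" using that by (cases j) auto
    then have "int N < int (j * Suc N)" by (simp only: of_nat_less_iff)
    then show "m - 2 * int (j * Suc N) < 0" using base by linarith
  qed
  then have "int j * c j (m - 2 * int (j * Suc N)) = 0" for j
    by (cases "j = 0") auto
  then show ?case unfolding shifted_sum_def by (simp only: sum.neutral_const) simp
next
  case (step k)
  let ?W = "shifted_sum (\<lambda>_. 1) N k"
  let ?T = "shifted_sum int N k"
  define U where "U m = (\<Sum>l=k..N. \<Sum>e=1..N. ?W (m - 2 * int (l * e)))" for m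
  \<comment> \<open>Division by 1 - q^(2k): \<open>?T\<close> and \<open>U\<close> agree after
    multiplication by this factor, so they agree by induction on the exponent.\<close>
  have "m \<le> int N \<Longrightarrow> ?T m = U m" for m
  proof (induction "nat (m + 1)" arbitrary: m rule: less_induct)
    case less
    show ?case
    proof (cases "m < 0")
      case True
      have "m - 2 * int (l * e) < 0" for l e
        using True by (smt (verit) of_nat_0_le_iff)
      with True show ?thesis by (simp add: U_def shifted_sum_neg)
    next
      case False
      have W_Suc: "shifted_sum (\<lambda>_. 1) N (Suc k) x = ?W x - ?W (x - 2 * int k)"
        if "x \<le> int N" for x
        using shifted_sum_Suc[OF that, of k "\<lambda>_. 1"] step.prems by simp
      have T_Suc: "shifted_sum int N (Suc k) m =
          ?T m - ?T (m - 2 * int k) - ?W (m - 2 * int k)"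
        using shifted_sum_Suc[OF less.prems, of k int] step.prems
        by (simp add: shifted_sum_def sum.distrib algebra_simps)
      have split: "{k..N} = insert k {Suc k..N}" using step.hyps by auto
      have shift: "m - 2 * int k - 2 * int (l * e) = m - 2 * int (l * e) - 2 * int k" for l e by simp
      \<comment> \<open>The factor 1 - q^(2k) reduces the geometric series of row
        \<open>l = k\<close> to q^(2k), up to a term that \<open>beyond\<close> shows to
        vanish.\<close>
      have telescope: "(\<Sum>e=1..M. ?W (m - 2 * int (k * e))) - (\<Sum>e=1..M. ?W (m - 2 * int k - 2 * int (k * e)))
          = ?W (m - 2 * int k) - ?W (m - 2 * int k - 2 * int (k * M))" for M
        by (induction M) (simp_all add: algebra_simps)
      have beyond: "?W (m - 2 * int k - 2 * int (k * N)) = 0"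
      proof (rule shifted_sum_neg)
        have "1 * int N \<le> int k * int N" using step.prems by (intro mult_right_mono) auto
        then show "m - 2 * int k - 2 * int (k * N) < 0" using step.prems less.prems by simp
      qed
      \<comment> \<open>In the rows \<open>l > k\<close> the same factor turns W_k into W_(k+1), and
        the induction hypothesis for \<open>Suc k\<close> applies.\<close>
      have rows: "(\<Sum>l=Suc k..N. \<Sum>e=1..N. ?W (m - 2 * int (l * e)))
          - (\<Sum>l=Suc k..N. \<Sum>e=1..N. ?W (m - 2 * int k - 2 * int (l * e)))
          = shifted_sum int N (Suc k) m"
      proof -
        have "m - 2 * int (l * e) \<le> int N" for l e
          using less.prems by (smt (verit) of_nat_0_le_iff)
        then show ?thesis
          using step.IH[of m] less.prems W_Suc
          by (simp add: shift sum_subtractf[symmetric] del: of_nat_mult)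
      qed
      have U_split: "U x = (\<Sum>e=1..N. ?W (x - 2 * int (k * e)))
          + (\<Sum>l=Suc k..N. \<Sum>e=1..N. ?W (x - 2 * int (l * e)))" for x
        unfolding U_def split by simp
      have "U m - U (m - 2 * int k) = ?W (m - 2 * int k) + shifted_sum int N (Suc k) m"
        using telescope[of N] beyond rows U_split[of m] U_split[of "m - 2 * int k"] by linarith
      moreover have "?T (m - 2 * int k) = U (m - 2 * int k)"
        using less.hyps[of "m - 2 * int k"] less.prems step.prems False by simp
      ultimately show ?thesis using T_Suc by simp
    qed
  qed
  then show ?case using step.prems unfolding U_def by simp
qed

lemma weighted_sum_eq:
  assumes "m \<le> int N"
  shows "(\<Sum>j\<le>N. int j * c j (m - 2 * int j)) = (\<Sum>l=1..N. \<Sum>e=1..N. c N (m - 2 * int (l * e)))"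
  using shifted_sum_weighted[of 1 N m] assms
  unfolding shifted_sum_1 by (simp add: shifted_sum_def)

end

section \<open>Ranks of strict partitions\<close>

lemma strict_partition_map_Suc_iff [simp]:
  "strict_partition (map Suc zs) \<longleftrightarrow> sorted_wrt (>) zs"
  by (simp add: strict_partition_def sorted_wrt_map)

text \<open>Removing the first column loses only parts equal to 1, and a strict partition has at
  most one of these.\<close>

lemma strict_partition_cases:
  assumes "strict_partition xs"
  obtains zs where "strict_partition zs" "xs = map Suc zs"
    | zs where "strict_partition zs" "xs = map Suc zs @ [1]"
proof -
  have "\<exists>zs. strict_partition zs \<and> (xs = map Suc zs \<or> xs = map Suc zs @ [1])"
    using assms
  proof (induction xs)
    case (Cons x xs)
    then obtain zs where zs: "strict_partition zs" "xs = map Suc zs \<or> xs = map Suc zs @ [1]"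
      by (auto simp: strict_partition_Cons)
    show ?case
    proof (cases "x = 1")
      case True
      then show ?thesis using Cons.prems
        by (intro exI[of _ "[]"]) (cases xs; auto simp: strict_partition_Cons)
    next
      case False
      then show ?thesis using zs Cons.prems
        by (intro exI[of _ "(x - 1) # zs"]) (auto simp: strict_partition_Cons less_diff_conv)
    qed
  qed simp
  then show ?thesis using that by blast
qed

definition rank :: "nat list \<Rightarrow> nat" where
  "rank xs = part xs 1 - length xs"

lemma distinct_partitions_0 [simp]: "distinct_partitions 0 = {[]}"
proof -
  have "xs = []" if "\<forall>x\<in>set xs. 0 < x" "sum_list xs = 0" for xs :: "nat list"
    using that by (cases xs) auto
  then show ?thesis by (auto simp: distinct_partitions_def strict_partition_def)
qed

lemma rank_Nil [simp]: "rank [] = 0"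
  by (simp add: rank_def part_def)

section \<open>Dyson's map and its inverse\<close>

definition dyson :: "nat \<Rightarrow> nat list \<Rightarrow> nat list" where
  "dyson s xs = (length xs + s) # filter (\<lambda>x. 0 < x) (map (\<lambda>x. x - 1) xs)"

text \<open>Restoring the first column must decide whether a part 1 was lost; this is so exactly
  when the image has rank \<open>s\<close> and not \<open>s - 1\<close>.\<close>

definition undyson :: "nat \<Rightarrow> nat list \<Rightarrow> nat list" where
  "undyson s ys = map Suc (tl ys) @ (if rank ys = s then [1] else [])"

lemma dyson_map_Suc:
  assumes "strict_partition zs"
  shows "dyson s (map Suc zs) = (length zs + s) # zs"
    and "dyson s (map Suc zs @ [1]) = (Suc (length zs) + s) # zs"
proof -
  have "filter (\<lambda>x. 0 < x) zs = zs"
    using assms by (intro filter_True) (auto simp: strict_partition_def)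
  then show "dyson s (map Suc zs) = (length zs + s) # zs"
    and "dyson s (map Suc zs @ [1]) = (Suc (length zs) + s) # zs"
    by (simp_all add: dyson_def o_def)
qed

lemma part_map_Suc_1:
  "part (map Suc zs @ ys) (Suc 0) = (if zs = [] then part ys (Suc 0) else Suc (part zs (Suc 0)))"
  by (cases zs) (auto simp: part_1_eq)

lemma sum_list_map_Suc: "sum_list (map Suc zs) = sum_list zs + length zs"
  by (induction zs) auto

text \<open>The bound \<open>rank xs \<le> s\<close> says exactly that the new first row is longer
  than all remaining rows.\<close>

lemma bij_betw_dyson:
  assumes "0 < s"
  shows "bij_betw (dyson s) {xs \<in> distinct_partitions m. rank xs \<le> s}
    {ys \<in> distinct_partitions (m + s). rank ys = s \<or> Suc (rank ys) = s}"
    (is "bij_betw _ ?A ?B")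
proof (rule bij_betw_byWitness[where f' = "undyson s"])
  have all: "dyson s xs \<in> ?B \<and> undyson s (dyson s xs) = xs" if "xs \<in> ?A" for xs
  proof -
    from that have xs: "strict_partition xs" "sum_list xs = m" "rank xs \<le> s"
      by (auto simp: distinct_partitions_def)
    from xs(1) show ?thesis
    proof (cases rule: strict_partition_cases)
      case (1 zs)
      then have "\<forall>y\<in>set zs. y < length zs + s"
        using xs(3) assms by (cases zs) (auto simp: rank_def part_1_eq strict_partition_Cons)
      then show ?thesis using 1 assms xs(2)
        by (simp add: 1 dyson_map_Suc distinct_partitions_def strict_partition_Cons undyson_def
            rank_def part_1_eq sum_list_map_Suc)
    next
      case (2 zs)
      then have "\<forall>y\<in>set zs. y < Suc (length zs + s)"
        using xs(3) assms by (cases zs) (auto simp: rank_def part_1_eq strict_partition_Cons)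
      then show ?thesis using 2 assms xs(2)
        by (simp add: 2 dyson_map_Suc(2)[simplified] distinct_partitions_def strict_partition_Cons undyson_def
            rank_def part_1_eq sum_list_map_Suc)
    qed
  qed
  then show "\<forall>xs\<in>?A. undyson s (dyson s xs) = xs" "dyson s ` ?A \<subseteq> ?B" by auto
  have all': "undyson s ys \<in> ?A \<and> dyson s (undyson s ys) = ys" if "ys \<in> ?B" for ys
  proof -
    from that have ys: "strict_partition ys" "sum_list ys = m + s"
      "rank ys = s \<or> Suc (rank ys) = s"
      by (auto simp: distinct_partitions_def)
    then obtain y zs where y: "ys = y # zs" using assms by (cases ys) auto
    have zs: "strict_partition zs" "\<forall>z\<in>set zs. z < y" using ys(1) by (auto simp: y strict_partition_Cons)
    have st: "strict_partition (map Suc zs @ [1])" "sorted_wrt (>) zs"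
      using zs(1) by (auto simp: strict_partition_def sorted_wrt_map sorted_wrt_append)
    have lt: "part zs (Suc 0) < y"
      using ys(1) by (cases zs) (auto simp: y strict_partition_Cons part_1_eq)
    have len: "Suc (length zs) \<le> y"
      using length_le_part_1[OF ys(1)] by (simp add: y part_1_eq)
    show ?thesis
    proof (cases "rank ys = s")
      case True
      then have "y = Suc (length zs) + s" using len by (simp add: rank_def part_1_eq y)
      then show ?thesis using True ys(2) zs st lt
        by (auto simp: undyson_def y dyson_map_Suc(2)[simplified] distinct_partitions_def
            sum_list_map_Suc rank_def part_map_Suc_1) (auto simp: part_1_eq)
    next
      case False
      then have "y = length zs + s" using len ys(3) by (auto simp: rank_def part_1_eq y)
      then show ?thesis using False ys(2) zs st lt part_map_Suc_1[of zs "[]"]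
        by (auto simp: undyson_def y dyson_map_Suc distinct_partitions_def
            sum_list_map_Suc rank_def)
    qed
  qed
  then show "\<forall>ys\<in>?B. dyson s (undyson s ys) = ys" "undyson s ` ?B \<subseteq> ?A" by auto
qed

section \<open>Counting strict partitions by rank\<close>

lemma distinct_partitions_subset: "distinct_partitions m \<subseteq> partitions m"
proof
  fix xs assume "xs \<in> distinct_partitions m"
  moreover have "sorted_wrt (>) xs \<Longrightarrow> sorted_wrt (\<ge>) xs"
    by (rule sorted_wrt_mono_rel[of _ "(>)"]) auto
  ultimately show "xs \<in> partitions m"
    by (auto simp: distinct_partitions_def strict_partition_def partitions_def)
qed

lemma finite_distinct_partitions [simp]: "finite (distinct_partitions m)"
  using finite_subset[OF distinct_partitions_subset finite_partitions] .

lemma rank_less: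
  assumes "xs \<in> distinct_partitions m" "0 < m"
  shows "rank xs < m"
  using assms
  by (cases xs) (auto simp: distinct_partitions_def rank_def part_1_eq strict_partition_Cons)

definition rank_count :: "nat \<Rightarrow> int \<Rightarrow> int" where
  "rank_count j m =
    (if m < 0 then 0 else int (card {xs \<in> distinct_partitions (nat m). rank xs \<le> 2 * j}))"

text \<open>Ranks are below \<open>m\<close> when \<open>m > 0\<close>, so the bound
  \<open>2 * j\<close> excludes nothing: C_j and C agree up to degree 2j + 1.\<close>

lemma rank_count_eq_card:
  assumes "m \<le> Suc (2 * j)"
  shows "rank_count j (int m) = int (card (distinct_partitions m))"
proof -
  have "{xs \<in> distinct_partitions m. rank xs \<le> 2 * j} = distinct_partitions m"
  proof (cases "m = 0")
    case True
    then show ?thesis by auto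
  next
    case False
    then show ?thesis using rank_less[of _ m] assms by fastforce
  qed
  then show ?thesis by (simp add: rank_count_def)
qed

text \<open>Dyson's map with \<open>s = 2 * Suc j\<close>. If \<open>s > m\<close>, both sides
  vanish because all ranks are too small.\<close>

lemma card_rank_pair:
  "int (card {xs \<in> distinct_partitions m. rank xs = 2 * Suc j \<or> Suc (rank xs) = 2 * Suc j})
    = rank_count (Suc j) (int m - 2 * int (Suc j))"
proof (cases "2 * Suc j \<le> m")
  case True
  then have m: "m - 2 * Suc j + 2 * Suc j = m" by simp
  have "nat (int m - 2 * int (Suc j)) = m - 2 * Suc j" using True by linarith
  then show ?thesis
    using bij_betw_same_card[OF bij_betw_dyson[of "2 * Suc j" "m - 2 * Suc j"]] True
    unfolding m by (simp add: rank_count_def)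
next
  case False
  have "rank xs \<noteq> 2 * Suc j \<and> Suc (rank xs) \<noteq> 2 * Suc j" if "xs \<in> distinct_partitions m" for xs
  proof (cases "m = 0")
    case True
    then show ?thesis using that by auto
  next
    case False
    then show ?thesis using rank_less[OF that] \<open>\<not> 2 * Suc j \<le> m\<close> by linarith
  qed
  then have "{xs \<in> distinct_partitions m. rank xs = 2 * Suc j \<or> Suc (rank xs) = 2 * Suc j} = {}"
    by auto
  then show ?thesis using False by (simp add: rank_count_def)
qed

interpretation rank_count: dyson_recurrence rank_count
proof
  fix j m
  show "m < 0 \<Longrightarrow> rank_count j m = 0" by (simp add: rank_count_def)
  show "rank_count (Suc j) m = rank_count j m + rank_count (Suc j) (m - 2 * int (Suc j))"
  proof (cases "m < 0")
    case True
    then show ?thesis by (simp add: rank_count_def)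
  next
    case False
    let ?D = "distinct_partitions (nat m)"
    have "{xs \<in> ?D. rank xs \<le> 2 * Suc j} = {xs \<in> ?D. rank xs \<le> 2 * j}
        \<union> {xs \<in> ?D. rank xs = 2 * Suc j \<or> Suc (rank xs) = 2 * Suc j}"
      by auto
    moreover have "{xs \<in> ?D. rank xs \<le> 2 * j}
        \<inter> {xs \<in> ?D. rank xs = 2 * Suc j \<or> Suc (rank xs) = 2 * Suc j} = {}"
      by auto
    ultimately have "card {xs \<in> ?D. rank xs \<le> 2 * Suc j} = card {xs \<in> ?D. rank xs \<le> 2 * j}
        + card {xs \<in> ?D. rank xs = 2 * Suc j \<or> Suc (rank xs) = 2 * Suc j}"
      by (simp add: card_Un_disjoint)
    then show ?thesis
      using card_rank_pair[of "nat m" j] False by (simp add: rank_count_def)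
  qed
qed

text \<open>For \<open>j > 0\<close>, the value \<open>j\<close> of the rounded-up half rank comes
  from the ranks 2j - 1 and 2j, counted by q^(2j) C_j. Grouping by \<open>j\<close> therefore gives
  T_1.\<close>

lemma sum_half_rank:
  "(\<Sum>xs\<in>distinct_partitions m. int (Suc (rank xs) div 2)) =
    (\<Sum>k=1..m. \<Sum>e=1..m. if 2 * (k * e) \<le> m
      then int (card (distinct_partitions (m - 2 * (k * e)))) else 0)"
proof -
  let ?D = "distinct_partitions m"
  have le: "Suc (rank xs) div 2 \<le> m" if "xs \<in> ?D" for xs
    using rank_less[OF that] that
    by (cases "m = 0") auto
  have level: "j * card {xs \<in> ?D. Suc (rank xs) div 2 = j}
      = int j * rank_count j (int m - 2 * int j)" for j
  proof (cases j)
    case (Suc i)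
    have "Suc r div 2 = Suc i \<longleftrightarrow> r = 2 * Suc i \<or> Suc r = 2 * Suc i" for r by presburger
    then show ?thesis unfolding Suc of_nat_mult card_rank_pair[symmetric] by (simp only:)
  qed simp
  have "(\<Sum>xs\<in>?D. int (Suc (rank xs) div 2))
      = (\<Sum>j\<le>m. \<Sum>xs\<in>{xs \<in> ?D. Suc (rank xs) div 2 = j}. int (Suc (rank xs) div 2))"
    using le by (intro sum.group[symmetric]) auto
  also have "\<dots> = (\<Sum>j\<le>m. int j * rank_count j (int m - 2 * int j))"
    using level by (intro sum.cong) auto
  also have "\<dots> = (\<Sum>k=1..m. \<Sum>e=1..m. rank_count m (int m - 2 * int (k * e)))"
    by (rule rank_count.weighted_sum_eq) simp
  also have "\<dots> = (\<Sum>k=1..m. \<Sum>e=1..m. if 2 * (k * e) \<le> m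
      then int (card (distinct_partitions (m - 2 * (k * e)))) else 0)"
  proof (intro sum.cong refl)
    fix k e
    show "rank_count m (int m - 2 * int (k * e)) = (if 2 * (k * e) \<le> m
      then int (card (distinct_partitions (m - 2 * (k * e)))) else 0)"
    proof (cases "2 * (k * e) \<le> m")
      case True
      then have "int m - 2 * int (k * e) = int (m - 2 * (k * e))" by simp
      then show ?thesis using True by (simp only: rank_count_eq_card) simp
    next
      case False
      then have "int m - 2 * int (k * e) < 0" by linarith
      then show ?thesis using False by (simp add: rank_count_def)
    qed
  qed
  finally show ?thesis .
qed

section \<open>Partitions with one repeated part size\<close>

definition partition_msets :: "nat \<Rightarrow> nat multiset set" where
  "partition_msets m = {M. 0 \<notin># M \<and> sum_mset M = m}"

lemma bij_betw_mset_partitions: "bij_betw mset (partitions m) (partition_msets m)"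
proof (rule bij_betw_byWitness[where f' = "\<lambda>M. rev (sorted_list_of_multiset M)"])
  show "\<forall>xs\<in>partitions m. rev (sorted_list_of_multiset (mset xs)) = xs"
  proof
    fix xs assume "xs \<in> partitions m"
    then have "sorted (rev xs)" by (simp add: partitions_def sorted_wrt_rev)
    then have "sort xs = rev xs"
      by (intro properties_for_sort) auto
    then show "rev (sorted_list_of_multiset (mset xs)) = xs"
      by (simp add: sorted_list_of_multiset_mset)
  qed
  show "mset ` partitions m \<subseteq> partition_msets m"
    by (auto simp: partitions_def partition_msets_def sum_mset_sum_list)
  show "(\<lambda>M. rev (sorted_list_of_multiset M)) ` partition_msets m \<subseteq> partitions m"
  proof
    fix xs assume "xs \<in> (\<lambda>M. rev (sorted_list_of_multiset M)) ` partition_msets m"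
    then obtain M where M: "0 \<notin># M" "sum_mset M = m" "xs = rev (sorted_list_of_multiset M)"
      by (auto simp: partition_msets_def)
    have "sum_list (sorted_list_of_multiset M) = m"
      using M(2) sum_mset_sum_list[of "sorted_list_of_multiset M"] by simp
    then show "xs \<in> partitions m"
      using M(1,3) by (auto simp: partitions_def sorted_wrt_rev intro: gr0I)
  qed
qed auto

lemma card_partitions_mset:
  "card {xs \<in> partitions m. P (mset xs)} = card {M \<in> partition_msets m. P M}"
proof (rule bij_betw_same_card)
  show "bij_betw mset {xs \<in> partitions m. P (mset xs)} {M \<in> partition_msets m. P M}"
    using bij_betw_mset_partitions[of m] by (auto simp: bij_betw_def inj_on_def)
qed

lemma distinct_partitions_eq: "distinct_partitions m = {xs \<in> partitions m. distinct xs}"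
proof -
  have "sorted_wrt (>) xs \<longleftrightarrow> sorted_wrt (\<ge>) xs \<and> distinct xs" for xs :: "nat list"
    by (induction xs) (auto simp: order_less_le)
  then show ?thesis
    by (auto simp: distinct_partitions_def strict_partition_def partitions_def)
qed

lemma card_distinct_partitions:
  "card (distinct_partitions m) = card {M \<in> partition_msets m. \<forall>x. count M x \<le> 1}"
proof -
  have "distinct xs \<longleftrightarrow> (\<forall>x. count (mset xs) x \<le> 1)" for xs :: "nat list"
    unfolding distinct_count_atmost_1
    by (auto simp: count_eq_zero_iff[symmetric] le_Suc_eq not_in_iff)
  then show ?thesis
    unfolding distinct_partitions_eq by (simp only: card_partitions_mset[where P = "\<lambda>M. \<forall>x. count M x \<le> 1"])
qed

lemma finite_partition_msets: "finite (partition_msets m)"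
  using bij_betw_finite[OF bij_betw_mset_partitions] finite_partitions by blast

text \<open>The part \<open>k\<close> occurs \<open>2 * e\<close> or \<open>2 * e + 1\<close> times;
  for \<open>e > 0\<close> it is the one repeated size.\<close>

definition repeated :: "nat \<Rightarrow> nat \<Rightarrow> nat \<Rightarrow> nat multiset set" where
  "repeated m k e = {M \<in> partition_msets m. count M k div 2 = e \<and> (\<forall>x. x \<noteq> k \<longrightarrow> count M x \<le> 1)}"

lemma finite_repeated: "finite (repeated m k e)"
  by (rule finite_subset[OF _ finite_partition_msets[of m]]) (auto simp: repeated_def)

lemma repeated_unique:
  assumes "M \<in> repeated m k e" "M \<in> repeated m k' e'" "0 < e" "0 < e'"
  shows "k = k' \<and> e = e'"
proof -
  have "1 < count M k" "1 < count M k'"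
    using assms by (auto simp: repeated_def)
  then have "k = k'" using assms(1) unfolding repeated_def by (auto dest: leD)
  then show ?thesis using assms(1,2) by (auto simp: repeated_def)
qed

text \<open>Taking away \<open>2 * e\<close> copies of \<open>k\<close> leaves at most one copy,
  hence a strict partition; adding them back is the inverse.\<close>

lemma card_repeated:
  assumes "0 < k"
  shows "card (repeated m k e) =
    (if 2 * (k * e) \<le> m then card (distinct_partitions (m - 2 * (k * e))) else 0)"
proof (cases "2 * (k * e) \<le> m")
  case True
  let ?R = "replicate_mset (2 * e) k"
  have R: "sum_mset ?R = 2 * (k * e)" by simp
  have "bij_betw (\<lambda>M. M + ?R) {M \<in> partition_msets (m - 2 * (k * e)). \<forall>x. count M x \<le> 1}
      (repeated m k e)"
  proof (rule bij_betw_byWitness[where f' = "\<lambda>M. M - ?R"])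
    show "\<forall>M\<in>repeated m k e. M - ?R + ?R = M"
    proof
      fix M assume "M \<in> repeated m k e"
      then have "?R \<subseteq># M" by (auto simp: repeated_def subseteq_mset_def)
      then show "M - ?R + ?R = M" by simp
    qed
    show "(\<lambda>M. M + ?R) ` {M \<in> partition_msets (m - 2 * (k * e)). \<forall>x. count M x \<le> 1}
        \<subseteq> repeated m k e"
    proof safe
      fix M assume M: "M \<in> partition_msets (m - 2 * (k * e))" "\<forall>x. count M x \<le> 1"
      have "(count M k + 2 * e) div 2 = e" using M(2)[rule_format, of k] by simp
      then show "M + ?R \<in> repeated m k e"
        using M True assms by (auto simp: repeated_def partition_msets_def split: if_splits)
    qed
    show "(\<lambda>M. M - ?R) ` repeated m k e
        \<subseteq> {M \<in> partition_msets (m - 2 * (k * e)). \<forall>x. count M x \<le> 1}"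
    proof safe
      fix M assume M: "M \<in> repeated m k e"
      then have sub: "?R \<subseteq># M" by (auto simp: repeated_def subseteq_mset_def)
      have "sum_mset M = sum_mset (M - ?R) + sum_mset ?R"
        using sub by (metis subset_mset.diff_add sum_mset.union)
      then show "M - ?R \<in> partition_msets (m - 2 * (k * e))"
        using M unfolding R by (auto simp: repeated_def partition_msets_def dest: in_diffD)
      fix x
      show "count (M - ?R) x \<le> 1"
      proof (cases "x = k")
        case True
        have "count M k \<le> 2 * e + 1" using M by (auto simp: repeated_def)
        then show ?thesis using True by simp
      next
        case False
        then have "count M x \<le> 1" using M by (auto simp: repeated_def)
        then show ?thesis by simp
      qed
    qed
  qed auto
  from bij_betw_same_card[OF this] show ?thesis
    using True by (simp add: card_distinct_partitions)
next
  case False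
  have "repeated m k e = {}"
  proof (rule ccontr)
    assume "repeated m k e \<noteq> {}"
    then obtain M where M: "M \<in> repeated m k e" by blast
    then have "replicate_mset (2 * e) k \<subseteq># M" by (auto simp: repeated_def subseteq_mset_def)
    then have "sum_mset M = sum_mset (M - replicate_mset (2 * e) k) + sum_mset (replicate_mset (2 * e) k)"
      by (metis subset_mset.diff_add sum_mset.union)
    then have "2 * (k * e) \<le> sum_mset M" by simp
    then show False using M False by (simp add: repeated_def partition_msets_def)
  qed
  then show ?thesis using False by simp
qed

text \<open>The repeated size and half its multiplicity, rounded down, sort the partitions into the
  disjoint classes \<open>repeated m k e\<close>.\<close>

lemma card_one_repeated:
  "card {xs \<in> partitions m. \<exists>!p. 1 < count_list xs p} =
    (\<Sum>k=1..m. \<Sum>e=1..m. if 2 * (k * e) \<le> m then card (distinct_partitions (m - 2 * (k * e))) else 0)"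
proof -
  let ?I = "{1..m} \<times> {1..m}"
  have "card {xs \<in> partitions m. \<exists>!p. 1 < count_list xs p}
      = card {M \<in> partition_msets m. \<exists>!p. 1 < count M p}"
    unfolding count_mset[symmetric] by (rule card_partitions_mset)
  also have "{M \<in> partition_msets m. \<exists>!p. 1 < count M p} = (\<Union>(k, e)\<in>?I. repeated m k e)"
  proof (intro set_eqI iffI)
    fix M assume "M \<in> {M \<in> partition_msets m. \<exists>!p. 1 < count M p}"
    then obtain p where M: "M \<in> partition_msets m" and p: "1 < count M p"
      and uniq: "\<And>q. 1 < count M q \<Longrightarrow> q = p"
      by blast
    have rep: "M \<in> repeated m p (count M p div 2)"
      using M uniq unfolding repeated_def by (auto intro: leI)
    have "p \<in># M" using p by (metis count_inI not_one_less_zero)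
    then have "0 < p" using M by (auto simp: partition_msets_def intro: gr0I)
    have "0 < count M p div 2" using p by auto
    \<comment> \<open>A nonempty class has \<open>2 * (k * e) \<le> m\<close> by
      \<open>card_repeated\<close>, which bounds both indices by \<open>m\<close>.\<close>
    have "card (repeated m p (count M p div 2)) \<noteq> 0"
      using rep finite_repeated by auto
    then have "2 * (p * (count M p div 2)) \<le> m"
      using card_repeated[OF \<open>0 < p\<close>, of m "count M p div 2"] by (auto split: if_splits)
    then have le: "p * (count M p div 2) \<le> m" by linarith
    have "p \<le> m" "count M p div 2 \<le> m"
      using order_trans[OF _ le] \<open>0 < p\<close> \<open>0 < count M p div 2\<close> by auto
    then have "(p, count M p div 2) \<in> ?I"
      using \<open>0 < p\<close> \<open>0 < count M p div 2\<close> by simp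
    with rep show "M \<in> (\<Union>(k, e)\<in>?I. repeated m k e)" by blast
  next
    fix M assume "M \<in> (\<Union>(k, e)\<in>?I. repeated m k e)"
    then obtain k e where ke: "1 \<le> e" "M \<in> repeated m k e" by auto
    then have "1 < count M k" by (auto simp: repeated_def)
    moreover have "q = k" if "1 < count M q" for q
      using that ke(2) unfolding repeated_def by (auto dest: leD)
    moreover have "M \<in> partition_msets m" using ke(2) by (simp add: repeated_def)
    ultimately show "M \<in> {M \<in> partition_msets m. \<exists>!p. 1 < count M p}" by blast
  qed
  also have "card \<dots> = (\<Sum>(k, e)\<in>?I. card (repeated m k e))"
    unfolding case_prod_unfold
  proof (rule card_UN_disjoint)
    show "\<forall>i\<in>?I. finite (repeated m (fst i) (snd i))"
      by (simp add: finite_repeated)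
    show "\<forall>i\<in>?I. \<forall>j\<in>?I. i \<noteq> j \<longrightarrow>
        repeated m (fst i) (snd i) \<inter> repeated m (fst j) (snd j) = {}"
    proof (intro ballI impI equals0I)
      fix i j M
      assume ij: "i \<in> ?I" "j \<in> ?I" "i \<noteq> j"
        and M: "M \<in> repeated m (fst i) (snd i) \<inter> repeated m (fst j) (snd j)"
      then have "fst i = fst j \<and> snd i = snd j"
        by (intro repeated_unique[of M m]) auto
      then show False using ij(3) by (simp add: prod_eq_iff)
    qed
  qed simp
  also have "\<dots> = (\<Sum>k=1..m. \<Sum>e=1..m. card (repeated m k e))"
    by (simp add: sum.cartesian_product)
  also have "\<dots> = (\<Sum>k=1..m. \<Sum>e=1..m.
      if 2 * (k * e) \<le> m then card (distinct_partitions (m - 2 * (k * e))) else 0)"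
    by (intro sum.cong refl card_repeated) auto
  finally show ?thesis .
qed

section \<open>Halving even partitions, and the final count\<close>

lemma even_partitions_eq:
  "even_partitions n = (if even n then map ((*) 2) ` partitions (n div 2) else {})"
proof -
  have sum2: "sum_list (map ((*) 2) xs) = 2 * sum_list xs" for xs :: "nat list"
    by (simp add: sum_list_const_mult)
  have "ps \<in> even_partitions n \<longleftrightarrow> (\<exists>xs\<in>partitions (n div 2). even n \<and> ps = map ((*) 2) xs)" for ps
  proof
    assume "ps \<in> even_partitions n"
    then have ps: "sorted_wrt (\<ge>) ps" "\<And>p. p \<in> set ps \<Longrightarrow> 0 < p \<and> even p" "sum_list ps = n"
      by (auto simp: even_partitions_def partitions_def)
    define xs where "xs = map (\<lambda>x. x div 2) ps"
    have eq: "map ((*) 2) xs = ps"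
      using ps(2) unfolding xs_def by (auto intro!: map_idI)
    have n: "n = 2 * sum_list xs"
      using ps(3) sum2[of xs] by (simp only: eq)
    have "sorted_wrt (\<ge>) xs"
      unfolding xs_def sorted_wrt_map
      by (rule sorted_wrt_mono_rel[OF _ ps(1)]) (simp add: div_le_mono)
    moreover have "0 < x" if "x \<in> set xs" for x
      using that ps(2)[of "2 * x"] unfolding eq[symmetric] by simp
    ultimately have "xs \<in> partitions (n div 2)"
      by (simp add: partitions_def n)
    then show "\<exists>xs\<in>partitions (n div 2). even n \<and> ps = map ((*) 2) xs"
      using eq n by auto
  next
    assume "\<exists>xs\<in>partitions (n div 2). even n \<and> ps = map ((*) 2) xs"
    then obtain xs where xs: "xs \<in> partitions (n div 2)" "even n" "ps = map ((*) 2) xs" by blast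
    then show "ps \<in> even_partitions n"
      by (simp add: even_partitions_def partitions_def sorted_wrt_map sum2)
  qed
  then show ?thesis by auto
qed

lemma inj_map_double: "inj (map ((*) (2::nat)))"
  by (intro inj_mapI) (simp add: inj_on_def)

lemma distinct_even_partitions_eq:
  "distinct_even_partitions n =
    (if even n then map ((*) 2) ` distinct_partitions (n div 2) else {})"
  by (auto simp: distinct_even_partitions_def even_partitions_eq distinct_partitions_eq
      distinct_map inj_on_def)

text \<open>Half of the even largest part is an integer, so the ceiling has no effect.\<close>

lemma M2_rank_map_double:
  assumes "strict_partition xs"
  shows "M2_rank (map ((*) 2) xs) = int (rank xs)"
  using length_le_part_1[OF assms]
  by (cases xs) (auto simp: M2_rank_def rank_def part_1_eq)

theorem theorem3p1:
  fixes n :: nat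
  assumes "n > 0"
  shows "int (s_c' n) - int (s_e n) =
    2 * int (card {ps \<in> even_partitions n. \<exists>!p. count_list ps p > 1})
    + int (card {ps \<in> distinct_even_partitions n. even (M2_rank ps)})"
proof (cases "even n")
  case False
  then show ?thesis
    by (simp add: s_c'_odd s_e_def distinct_even_partitions_eq even_partitions_eq)
next
  case True
  then obtain m where n: "n = 2 * m" by auto
  let ?D = "distinct_partitions m"
  have "s_e n = (\<Sum>xs\<in>?D. length xs)"
    unfolding s_e_def distinct_even_partitions_eq n
    by (simp add: sum.reindex inj_on_subset[OF inj_map_double])
  moreover have "s_c' n = (\<Sum>xs\<in>?D. Suc (part xs 1))"
    using s_c'_even assms n by simp
  ultimately have "int (s_c' n) - int (s_e n) = (\<Sum>xs\<in>?D. int (Suc (part xs 1)) - int (length xs))"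
    by (simp add: sum_subtractf)
  \<comment> \<open>With r the rank, each summand is r + 1, which is twice the rounded-up half of r,
    plus 1 if r is even.\<close>
  also have "\<dots> = (\<Sum>xs\<in>?D. 2 * int (Suc (rank xs) div 2) + (if even (rank xs) then 1 else 0))"
  proof (intro sum.cong refl)
    fix xs assume "xs \<in> ?D"
    then have "int (Suc (part xs 1)) - int (length xs) = int (Suc (rank xs))"
      using length_le_part_1[of xs] by (simp add: distinct_partitions_def rank_def)
    also have "Suc r = 2 * (Suc r div 2) + (if even r then 1 else 0)" for r
      by (simp; presburger)
    finally show "int (Suc (part xs 1)) - int (length xs)
        = 2 * int (Suc (rank xs) div 2) + (if even (rank xs) then 1 else 0)"
      by auto
  qed
  also have "\<dots> = 2 * (\<Sum>xs\<in>?D. int (Suc (rank xs) div 2)) + int (card {xs \<in> ?D. even (rank xs)})"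
    by (simp add: sum.distrib sum_distrib_left sum.If_cases Int_def)
  also have "(\<Sum>xs\<in>?D. int (Suc (rank xs) div 2))
      = int (card {xs \<in> partitions m. \<exists>!p. 1 < count_list xs p})"
    unfolding sum_half_rank card_one_repeated by (auto intro!: sum.cong)
  also have "card {xs \<in> partitions m. \<exists>!p. 1 < count_list xs p}
      = card {ps \<in> even_partitions n. \<exists>!p. 1 < count_list ps p}"
  proof -
    \<comment> \<open>Doubling preserves multiplicities and moves a repeated size \<open>q\<close>
      to \<open>2 * q\<close>; odd sizes do not occur.\<close>
    have "(\<exists>!p. 1 < count_list (map ((*) 2) xs) p) \<longleftrightarrow> (\<exists>!p. 1 < count_list xs p)" for xs :: "nat list"
    proof -
      have half: "count_list (map ((*) 2) xs) (2 * p) = count_list xs p" for p :: nat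
        by (induction xs) auto
      have "\<exists>q. p = 2 * q" if "1 < count_list (map ((*) 2) xs) p" for p :: nat
      proof -
        have "p \<in> set (map ((*) 2) xs)"
          using that by (metis count_list_0_iff not_one_less_zero)
        then show ?thesis by auto
      qed
      then have "1 < count_list (map ((*) 2) xs) p \<longleftrightarrow> (\<exists>q. p = 2 * q \<and> 1 < count_list xs q)" for p
        using half by metis
      moreover have "(\<exists>!p. \<exists>q. p = 2 * q \<and> P q) \<longleftrightarrow> (\<exists>!q. P q)" for P :: "nat \<Rightarrow> bool"
        unfolding Ex1_def by (metis nat_mult_eq_cancel1 zero_less_numeral)
      ultimately show ?thesis by simp
    qed
    moreover have "{ps \<in> even_partitions n. P ps} = map ((*) 2) ` {xs \<in> partitions m. P (map ((*) 2) xs)}" for P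
      unfolding even_partitions_eq n by auto
    ultimately have "{ps \<in> even_partitions n. \<exists>!p. 1 < count_list ps p}
        = map ((*) 2) ` {xs \<in> partitions m. \<exists>!p. 1 < count_list xs p}"
      by simp
    then show ?thesis
      by (simp add: card_image inj_on_subset[OF inj_map_double])
  qed
  also have "card {xs \<in> ?D. even (rank xs)} = card {ps \<in> distinct_even_partitions n. even (M2_rank ps)}"
  proof -
    have "{ps \<in> distinct_even_partitions n. even (M2_rank ps)} = map ((*) 2) ` {xs \<in> ?D. even (rank xs)}"
      unfolding distinct_even_partitions_eq n
      by (auto simp: distinct_partitions_def M2_rank_map_double)
    then show ?thesis
      by (simp add: card_image inj_on_subset[OF inj_map_double])
  qed
  finally show ?thesis .
qed

end
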